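(* For all $a,b\in\mathbb{N}$, the Hopi rectangle graph $HD(a,b)$ satisfies $$Z_{(2)}(HD(a,b))=Z_{(3)}(HD(a,b))=2(a+b),$$ and for all $\ell\ge4$, $$Z_{(\ell)}(HD(a,b))=a+b+2ab.$$
   Context: All graphs are finite, simple and undirected; $\mathbb{N}$ denotes the positive integers. Hopi rectangle graph: for $a,b\in\mathbb{N}$, view the vertices of the grid graph $P_{a+b}\square P_{a+b}$ as the integer pairs $(i,j)$ with $0\le i,j\le a+b-1$, two pairs being adjacent iff they differ by $\pm(1,0)$ or $\pm(0,1)$. The Hopi rectangle graph $HD(a,b)$ of order $(a,b)$ is the subgraph of $P_{a+b}\square P_{a+b}$ induced by the vertex set $$\{(i,j): a-1\le i+j\le 2b+a-1 \text{ and } |i-j|\le a\}.$$ Zero forcing color change rule: given a coloring of $V(G)$ in blue and white, a blue vertex $u$ having exactly one white neighbor $v$ may force $v$ to become blue. For an integer $\ell\ge0$, a set $B\subseteq V(G)$ is an $\ell$-leaky forcing set if for every choice of a set $L\subseteq V(G)$ of at most $\ell$ vertices (the leaks), starting with exactly the vertices of $B$ blue and repeatedly applying the color change rule, where vertices of $L$ are not allowed to perform forces, all vertices of $G$ eventually become blue. The $\ell$-leaky forcing number $Z_{(\ell)}(G)$ is the minimum cardinality of an $\ell$-leaky forcing set of $G$. *)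

theory Defs
  imports "Graph_Theory.Graph_Theory"
begin

text \<open>
  A finite simple undirected graph is a digraph satisfying the locale \<^locale>\<open>graph\<close>: every edge
  is represented by its two opposite arcs, and \<open>u \<rightarrow>\<^bsub>G\<^esub> v\<close> is adjacency.
\<close>

definition white_nbrs :: "('a, 'b) pre_digraph \<Rightarrow> 'a set \<Rightarrow> 'a \<Rightarrow> 'a set" where
  "white_nbrs G S u = {v. u \<rightarrow>\<^bsub>G\<^esub> v \<and> v \<notin> S}"

text \<open>\<open>S\<close> and \<open>S'\<close> are the sets of blue vertices before and after a single force.\<close>

definition leaky_force_step :: "('a, 'b) pre_digraph \<Rightarrow> 'a set \<Rightarrow> 'a set \<Rightarrow> 'a set \<Rightarrow> bool" where
  "leaky_force_step G L S S' \<longleftrightarrow>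
     (\<exists>u v. u \<in> S \<and> u \<notin> L \<and> white_nbrs G S u = {v} \<and> S' = insert v S)"

definition leaky_forcing_set :: "('a, 'b) pre_digraph \<Rightarrow> nat \<Rightarrow> 'a set \<Rightarrow> bool" where
  "leaky_forcing_set G l B \<longleftrightarrow>
     B \<subseteq> verts G \<and>
     (\<forall>L. L \<subseteq> verts G \<and> card L \<le> l \<longrightarrow> (leaky_force_step G L)\<^sup>*\<^sup>* B (verts G))"

definition leaky_forcing_number :: "('a, 'b) pre_digraph \<Rightarrow> nat \<Rightarrow> nat" where
  "leaky_forcing_number G l = Min (card ` {B. leaky_forcing_set G l B})"

text \<open>The minimum is taken over a finite nonempty set.\<close>

lemma leaky_forcing_set_verts: "leaky_forcing_set G l (verts G)"
  by (simp add: leaky_forcing_set_def)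

lemma finite_leaky_forcing_sets:
  assumes "finite (verts G)"
  shows "finite {B. leaky_forcing_set G l B}"
  using assms by (auto simp: leaky_forcing_set_def intro: finite_subset[of _ "Pow (verts G)"])

definition square_grid :: "nat \<Rightarrow> (int \<times> int, (int \<times> int) \<times> (int \<times> int)) pre_digraph" where
  "square_grid n = with_proj
     \<lparr> pverts = {0..<int n} \<times> {0..<int n},
       parcs = {(p, q). p \<in> {0..<int n} \<times> {0..<int n} \<and> q \<in> {0..<int n} \<times> {0..<int n} \<and>
                        (fst q - fst p, snd q - snd p) \<in> {(1, 0), (-1, 0), (0, 1), (0, -1)}} \<rparr>"

text \<open>
  \<open>G \<restriction> S\<close> has vertex set \<open>S\<close> even if \<open>S\<close> is not contained in \<open>verts G\<close>, hence the explicit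
  membership condition.
\<close>

definition hopi_rectangle ::
    "nat \<Rightarrow> nat \<Rightarrow> (int \<times> int, (int \<times> int) \<times> (int \<times> int)) pre_digraph" where
  "hopi_rectangle a b = square_grid (a + b) \<restriction>
     {(i, j). (i, j) \<in> verts (square_grid (a + b)) \<and>
              int a - 1 \<le> i + j \<and> i + j \<le> 2 * int b + int a - 1 \<and> \<bar>i - j\<bar> \<le> int a}"

lemma graph_square_grid: "graph (square_grid n)"
proof -
  let ?V = "{0..<int n} \<times> {0..<int n}"
  have "arcs (square_grid n) \<subseteq> ?V \<times> ?V"
    by (auto simp: square_grid_def)
  then have "finite (arcs (square_grid n))"
    by (rule finite_subset) auto
  then show ?thesis
    by unfold_locales
      (auto simp: square_grid_def arc_to_ends_def symmetric_def sym_def)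
qed

lemma graph_hopi_rectangle: "graph (hopi_rectangle a b)"
proof -
  interpret graph "square_grid (a + b)" by (rule graph_square_grid)
  have ind: "induced_subgraph (hopi_rectangle a b) (square_grid (a + b))"
    unfolding hopi_rectangle_def by (rule induced_induce) auto
  interpret H: digraph "hopi_rectangle a b" by (rule digraphI_induced[OF ind])
  interpret H: sym_digraph "hopi_rectangle a b" by (rule induced_graph_imp_graph[OF ind])
  show ?thesis by unfold_locales
qed

end

theory Submission
  imports Defs
begin

text \<open>
  A vertex of degree at most \<open>l\<close> lies in every \<open>l\<close>-leaky forcing set, because otherwise placing the
  leaks on its neighbours keeps it white. All degrees are at most \<open>4\<close>, which settles \<open>l \<ge> 4\<close>, and
  the \<open>2 (a + b)\<close> vertices on the four sides of the rectangle have degree \<open>2\<close>. Conversely, these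
  sides form a \<open>3\<close>-leaky forcing set: let \<open>W\<close> be a nonempty set of interior vertices. On the line
  \<open>i + j = max\<close> through \<open>W\<close> take the two extreme elements of \<open>W\<close>; the outer neighbour beyond each of
  them on the line \<open>i + j = max + 1\<close> has no other neighbour in \<open>W\<close>. The line \<open>i + j = min\<close> gives two
  more such vertices, so three leaks cannot prevent all four of them from forcing.
\<close>

section \<open>Leaky forcing\<close>

lemma leaky_forcing_set_mono:
  assumes "leaky_forcing_set G l B" and "k \<le> l"
  shows "leaky_forcing_set G k B"
  using assms unfolding leaky_forcing_set_def by (meson le_trans)

lemma low_degree_in_leaky_forcing_set:
  assumes B: "leaky_forcing_set G l B" and v: "v \<in> verts G"
    and nbrs: "{u. u \<rightarrow>\<^bsub>G\<^esub> v} \<subseteq> verts G" and deg: "card {u. u \<rightarrow>\<^bsub>G\<^esub> v} \<le> l"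
  shows "v \<in> B"
proof (rule ccontr)
  assume "v \<notin> B"
  let ?L = "{u. u \<rightarrow>\<^bsub>G\<^esub> v}"
  have "(leaky_force_step G ?L)\<^sup>*\<^sup>* B (verts G)"
    using B nbrs deg by (auto simp: leaky_forcing_set_def)
  then have "v \<notin> verts G"
  \<comment> \<open>Invariant: \<open>v\<close> stays white, because only some \<open>u\<close>
    adjacent to \<open>v\<close> could force it, and every such \<open>u\<close> is a leak.\<close>
  proof (induction rule: rtranclp_induct)
    case base
    show ?case by (fact \<open>v \<notin> B\<close>)
  next
    case (step S S')
    then show ?case
      by (auto simp: leaky_force_step_def white_nbrs_def)
  qed
  with v show False by simp
qed

text \<open>Each force lowers the number of white vertices, so a process that never stalls above
  \<open>B\<close> reaches \<open>verts G\<close>.\<close>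

lemma rtranclp_leaky_force_step_verts:
  assumes fin: "finite (verts G)" and wf: "wf_digraph G" and B: "B \<subseteq> verts G"
    and progress: "\<And>S. B \<subseteq> S \<Longrightarrow> S \<subset> verts G \<Longrightarrow> \<exists>u\<in>S - L. \<exists>v. white_nbrs G S u = {v}"
  shows "(leaky_force_step G L)\<^sup>*\<^sup>* B (verts G)"
proof -
  have "(leaky_force_step G L)\<^sup>*\<^sup>* S (verts G)" if "B \<subseteq> S" "S \<subseteq> verts G" for S
    using that
  proof (induction "card (verts G - S)" arbitrary: S rule: less_induct)
    case less
    show ?case
    proof (cases "S = verts G")
      case False
      with less.prems progress[of S] obtain u v
        where uv: "u \<in> S" "u \<notin> L" "white_nbrs G S u = {v}" by blast
      then have "u \<rightarrow>\<^bsub>G\<^esub> v" "v \<notin> S"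
        by (auto simp: white_nbrs_def)
      then have v: "v \<in> verts G - S"
        using wf_digraph.adj_in_verts(2)[OF wf] by blast
      then have "card (verts G - insert v S) < card (verts G - S)"
        using fin by (intro psubset_card_mono) auto
      with less.prems v have "(leaky_force_step G L)\<^sup>*\<^sup>* (insert v S) (verts G)"
        by (intro less.hyps) auto
      moreover have "leaky_force_step G L S (insert v S)"
        using uv by (auto simp: leaky_force_step_def)
      ultimately show ?thesis by (rule converse_rtranclp_into_rtranclp[rotated])
    qed simp
  qed
  with B show ?thesis by blast
qed

text \<open>Pigeonhole: \<open>F\<close> is found without knowing the leaks, and being larger than
  \<open>l\<close> it contains a vertex outside \<open>L\<close>.\<close>

lemma leaky_forcing_setI:
  assumes fin: "finite (verts G)" and wf: "wf_digraph G" and B: "B \<subseteq> verts G"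
    and forcers: "\<And>S. B \<subseteq> S \<Longrightarrow> S \<subset> verts G \<Longrightarrow>
      \<exists>F\<subseteq>S. l < card F \<and> (\<forall>u\<in>F. \<exists>v. white_nbrs G S u = {v})"
  shows "leaky_forcing_set G l B"
  unfolding leaky_forcing_set_def
proof (intro conjI allI impI)
  fix L assume L: "L \<subseteq> verts G \<and> card L \<le> l"
  show "(leaky_force_step G L)\<^sup>*\<^sup>* B (verts G)"
  proof (rule rtranclp_leaky_force_step_verts[OF fin wf B])
    fix S assume "B \<subseteq> S" "S \<subset> verts G"
    from forcers[OF this] obtain F where
      F: "F \<subseteq> S" "l < card F" "\<forall>u\<in>F. \<exists>v. white_nbrs G S u = {v}" by blast
    \<comment> \<open>For an infinite \<open>L\<close> the bound \<open>card L \<le> l\<close> would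
      say nothing, as \<open>card\<close> is then \<open>0\<close>.\<close>
    from L fin have "finite L" by (auto dest: finite_subset)
    with F(2) L have "\<not> F \<subseteq> L" by (meson card_mono leD le_less_trans)
    with F show "\<exists>u\<in>S - L. \<exists>v. white_nbrs G S u = {v}" by blast
  qed
qed (fact B)

text \<open>Minimality with respect to inclusion suffices here: in both ranges of \<open>l\<close>
  one leaky forcing set is contained in all others.\<close>

lemma leaky_forcing_number_eqI:
  assumes fin: "finite (verts G)" and B: "leaky_forcing_set G l B"
    and least: "\<And>B'. leaky_forcing_set G l B' \<Longrightarrow> B \<subseteq> B'"
  shows "leaky_forcing_number G l = card B"
  unfolding leaky_forcing_number_def
proof (rule Min_eqI)
  show "finite (card ` {B. leaky_forcing_set G l B})"
    using finite_leaky_forcing_sets[OF fin] by simp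
next
  fix n assume "n \<in> card ` {B. leaky_forcing_set G l B}"
  then obtain B' where B': "leaky_forcing_set G l B'" "n = card B'" by auto
  then have "finite B'"
    using fin finite_subset by (auto simp: leaky_forcing_set_def)
  with B' least show "card B \<le> n" by (simp add: card_mono)
qed (use B in blast)

section \<open>The Hopi rectangle\<close>

text \<open>
  The constraint that the coordinates lie in \<open>{0..<a + b}\<close> is redundant: it could only be violated at
  the four corners, which do not have integer coordinates.
\<close>

lemma verts_hopi:
  "verts (hopi_rectangle a b) =
     {(i, j). int a - 1 \<le> i + j \<and> i + j \<le> 2 * int b + int a - 1 \<and> \<bar>i - j\<bar> \<le> int a}"
  by (auto simp: hopi_rectangle_def square_grid_def)

lemma adj_hopi:
  "p \<rightarrow>\<^bsub>hopi_rectangle a b\<^esub> q \<longleftrightarrow>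
     p \<in> verts (hopi_rectangle a b) \<and> q \<in> verts (hopi_rectangle a b) \<and>
     (fst q - fst p, snd q - snd p) \<in> {(1, 0), (-1, 0), (0, 1), (0, -1)}"
proof -
  have "arcs_ends (hopi_rectangle a b) = arcs (hopi_rectangle a b)"
    by (simp add: arcs_ends_def arc_to_ends_def hopi_rectangle_def square_grid_def)
  then show ?thesis
    by (cases p; cases q) (auto simp: hopi_rectangle_def square_grid_def)
qed

lemma finite_verts_hopi: "finite (verts (hopi_rectangle a b))"
  by (rule finite_subset[of _ "verts (square_grid (a + b))"])
    (auto simp: hopi_rectangle_def square_grid_def)

section \<open>Degrees in the rectangle and on its sides\<close>

definition hopi_sides :: "nat \<Rightarrow> nat \<Rightarrow> (int \<times> int) set" where
  "hopi_sides a b = {(i, j) \<in> verts (hopi_rectangle a b).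
     i + j = int a - 1 \<or> i + j = 2 * int b + int a - 1 \<or> \<bar>i - j\<bar> = int a}"

lemma card_in_nbrs_hopi: "card {u. u \<rightarrow>\<^bsub>hopi_rectangle a b\<^esub> v} \<le> 4"
proof -
  obtain i j where v: "v = (i, j)" by force
  have "card {u. u \<rightarrow>\<^bsub>hopi_rectangle a b\<^esub> v} \<le> card (set [(i+1,j), (i-1,j), (i,j+1), (i,j-1)])"
    by (rule card_mono) (auto simp: adj_hopi v)
  also have "\<dots> \<le> 4"
    by (rule order.trans[OF card_length]) simp
  finally show ?thesis .
qed

lemma card_in_nbrs_hopi_sides:
  assumes "v \<in> hopi_sides a b"
  shows "card {u. u \<rightarrow>\<^bsub>hopi_rectangle a b\<^esub> v} \<le> 2"
proof -
  obtain i j where v: "v = (i, j)" by force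
  have "\<exists>p q. {u. u \<rightarrow>\<^bsub>hopi_rectangle a b\<^esub> v} \<subseteq> {p, q}"
  proof -
    \<comment> \<open>On each side one defining inequality is tight, so the two grid steps pointing
      outwards leave the rectangle.\<close>
    consider "i + j = int a - 1" | "i + j = 2 * int b + int a - 1" | "i - j = int a" | "i - j = - int a"
      using assms unfolding hopi_sides_def v by force
    then show ?thesis
    proof cases
      case 1
      then have "{u. u \<rightarrow>\<^bsub>hopi_rectangle a b\<^esub> v} \<subseteq> {(i+1,j), (i,j+1)}"
        by (auto simp: adj_hopi verts_hopi v)
      then show ?thesis by blast
    next
      case 2
      then have "{u. u \<rightarrow>\<^bsub>hopi_rectangle a b\<^esub> v} \<subseteq> {(i-1,j), (i,j-1)}"
        by (auto simp: adj_hopi verts_hopi v)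
      then show ?thesis by blast
    next
      case 3
      then have "{u. u \<rightarrow>\<^bsub>hopi_rectangle a b\<^esub> v} \<subseteq> {(i-1,j), (i,j+1)}"
        by (auto simp: adj_hopi verts_hopi v)
      then show ?thesis by blast
    next
      case 4
      then have "{u. u \<rightarrow>\<^bsub>hopi_rectangle a b\<^esub> v} \<subseteq> {(i+1,j), (i,j-1)}"
        by (auto simp: adj_hopi verts_hopi v)
      then show ?thesis by blast
    qed
  qed
  then obtain p q where "{u. u \<rightarrow>\<^bsub>hopi_rectangle a b\<^esub> v} \<subseteq> {p, q}" by blast
  then have "card {u. u \<rightarrow>\<^bsub>hopi_rectangle a b\<^esub> v} \<le> card {p, q}"
    by (intro card_mono) auto
  also have "\<dots> \<le> 2"
    by (simp add: card_insert_if)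
  finally show ?thesis .
qed

section \<open>The sides as a 3-leaky forcing set\<close>

lemma ex_lex_max:
  fixes f :: "'a \<Rightarrow> 'b::linorder" and g :: "'a \<Rightarrow> 'c::linorder"
  assumes "finite W" "W \<noteq> {}"
  shows "\<exists>p\<in>W. \<forall>q\<in>W. f q \<le> f p \<and> (f q = f p \<longrightarrow> g q \<le> g p)"
proof -
  \<comment> \<open>Maximise \<open>f\<close> first, then \<open>g\<close> among the maximisers.
    Negated arguments later turn either maximum into a minimum.\<close>
  define W' where "W' = {p \<in> W. f p = Max (f ` W)}"
  have "Max (f ` W) \<in> f ` W" using assms by (intro Max_in) auto
  then have W': "finite W'" "W' \<noteq> {}"
    using assms(1) by (force simp: W'_def)+
  then have "Max (g ` W') \<in> g ` W'" by (intro Max_in) auto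
  then obtain p where "p \<in> W'" "g p = Max (g ` W')" by auto
  then show ?thesis
    using assms W' by (intro bexI[of _ p]) (auto simp: W'_def)
qed

lemma leaky_forcing_set_hopi_sides: "leaky_forcing_set (hopi_rectangle a b) 3 (hopi_sides a b)"
proof (rule leaky_forcing_setI)
  let ?G = "hopi_rectangle a b"
  show "finite (verts ?G)" by (rule finite_verts_hopi)
  show "wf_digraph ?G"
    using graph_hopi_rectangle[of a b] by (simp add: graph_def digraph_def fin_digraph_def)
  show "hopi_sides a b \<subseteq> verts ?G" by (auto simp: hopi_sides_def)
  fix S assume S: "hopi_sides a b \<subseteq> S" "S \<subset> verts ?G"
  define W where "W = verts ?G - S"
  have W: "finite W" "W \<noteq> {}"
    using S finite_verts_hopi by (auto simp: W_def)
  have white: "white_nbrs ?G S u = {v}"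
    if "u \<rightarrow>\<^bsub>?G\<^esub> v" "v \<in> W" "\<And>w. u \<rightarrow>\<^bsub>?G\<^esub> w \<Longrightarrow> w \<in> W \<Longrightarrow> w = v" for u v
    using that by (auto simp: white_nbrs_def W_def adj_hopi)
  \<comment> \<open>The sides are blue, so a white vertex satisfies all defining inequalities
    strictly and keeps its four grid neighbours.\<close>
  have nbr: "(i, j) \<in> verts ?G \<and> (i+1, j) \<in> verts ?G \<and> (i-1, j) \<in> verts ?G \<and>
      (i, j+1) \<in> verts ?G \<and> (i, j-1) \<in> verts ?G"
    if "(i, j) \<in> W" for i j
    using that S(1) by (auto simp: W_def hopi_sides_def verts_hopi)
  obtain i1 j1 where p1: "(i1, j1) \<in> W"
    "\<And>i j. (i, j) \<in> W \<Longrightarrow> i + j \<le> i1 + j1 \<and> (i + j = i1 + j1 \<longrightarrow> i \<le> i1)"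
    using ex_lex_max[OF W, of "\<lambda>(i, j). i + j" fst] by fastforce
  obtain i2 j2 where p2: "(i2, j2) \<in> W"
    "\<And>i j. (i, j) \<in> W \<Longrightarrow> i + j \<le> i2 + j2 \<and> (i + j = i2 + j2 \<longrightarrow> i2 \<le> i)"
    using ex_lex_max[OF W, of "\<lambda>(i, j). i + j" "\<lambda>(i, j). - i"] by fastforce
  obtain i3 j3 where p3: "(i3, j3) \<in> W"
    "\<And>i j. (i, j) \<in> W \<Longrightarrow> i3 + j3 \<le> i + j \<and> (i + j = i3 + j3 \<longrightarrow> i \<le> i3)"
    using ex_lex_max[OF W, of "\<lambda>(i, j). - (i + j)" fst] by fastforce
  obtain i4 j4 where p4: "(i4, j4) \<in> W"
    "\<And>i j. (i, j) \<in> W \<Longrightarrow> i4 + j4 \<le> i + j \<and> (i + j = i4 + j4 \<longrightarrow> i4 \<le> i)"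
    using ex_lex_max[OF W, of "\<lambda>(i, j). - (i + j)" "\<lambda>(i, j). - i"] by fastforce
  \<comment> \<open>Each step leaves the strip of coordinate sums occupied by \<open>W\<close>.
    Apart from the chosen vertex, the new vertex has one neighbour on that vertex's line of constant
    \<open>i + j\<close>, lying beyond the extreme element: for \<open>(i1 + 1, j1)\<close> it is
    \<open>(i1 + 1, j1 - 1)\<close>, excluded from \<open>W\<close> by the maximality of
    \<open>i1\<close>.\<close>
  let ?F = "{(i1 + 1, j1), (i2, j2 + 1), (i3, j3 - 1), (i4 - 1, j4)}"
  have "white_nbrs ?G S (i1 + 1, j1) = {(i1, j1)}"
    using nbr[OF p1(1)] p1 by (intro white) (force simp: adj_hopi)+
  moreover have "white_nbrs ?G S (i2, j2 + 1) = {(i2, j2)}"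
    using nbr[OF p2(1)] p2 by (intro white) (force simp: adj_hopi)+
  moreover have "white_nbrs ?G S (i3, j3 - 1) = {(i3, j3)}"
    using nbr[OF p3(1)] p3 by (intro white) (force simp: adj_hopi)+
  moreover have "white_nbrs ?G S (i4 - 1, j4) = {(i4, j4)}"
    using nbr[OF p4(1)] p4 by (intro white) (force simp: adj_hopi)+
  moreover have "?F \<subseteq> S"
  proof -
    have "?F \<inter> W = {}"
      using p1(2) p2(2) p3(2) p4(2) by force
    moreover have "?F \<subseteq> verts ?G"
      using nbr[OF p1(1)] nbr[OF p2(1)] nbr[OF p3(1)] nbr[OF p4(1)] by auto
    ultimately show ?thesis by (auto simp: W_def)
  qed
  moreover have "card ?F = 4"
  proof -
    \<comment> \<open>Distinct even if \<open>W\<close> is a single vertex: the sums are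
      \<open>max + 1\<close> and \<open>min - 1\<close>, and within each pair the first coordinates
      differ since \<open>i2 < i1 + 1\<close> and \<open>i4 - 1 < i3\<close>.\<close>
    have "i1 + j1 = i2 + j2" "i3 + j3 = i4 + j4" "i3 + j3 \<le> i1 + j1" "i2 \<le> i1" "i4 \<le> i3"
      using p1(2)[OF p2(1)] p2(2)[OF p1(1)] p3(2)[OF p4(1)] p4(2)[OF p3(1)] p3(2)[OF p1(1)] by auto
    then show ?thesis by (auto simp: card_insert_if)
  qed
  ultimately show "\<exists>F\<subseteq>S. 3 < card F \<and> (\<forall>u\<in>F. \<exists>v. white_nbrs ?G S u = {v})"
    by (intro exI[of _ ?F]) auto
qed

section \<open>Vertices forced into every leaky forcing set\<close>

lemma hopi_sides_subset_leaky_forcing_set: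
  assumes "leaky_forcing_set (hopi_rectangle a b) l B" "2 \<le> l"
  shows "hopi_sides a b \<subseteq> B"
proof
  fix v assume v: "v \<in> hopi_sides a b"
  show "v \<in> B"
    using v card_in_nbrs_hopi_sides[OF v] assms
    by (intro low_degree_in_leaky_forcing_set[OF assms(1)]) (auto simp: hopi_sides_def adj_hopi)
qed

lemma verts_hopi_subset_leaky_forcing_set:
  assumes "leaky_forcing_set (hopi_rectangle a b) l B" "4 \<le> l"
  shows "verts (hopi_rectangle a b) \<subseteq> B"
proof
  fix v assume v: "v \<in> verts (hopi_rectangle a b)"
  show "v \<in> B"
    by (rule low_degree_in_leaky_forcing_set[OF assms(1) v _
          order.trans[OF card_in_nbrs_hopi assms(2)]])
      (auto simp: adj_hopi)
qed

section \<open>Counting in diagonal coordinates\<close>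

text \<open>
  Coordinates along the two diagonal directions: the vertices with \<open>i + j - (a - 1)\<close> even are the
  values of \<open>hopi_even a\<close>, the other vertices are the values of \<open>hopi_odd a\<close>.
\<close>

definition hopi_even :: "nat \<Rightarrow> int \<times> int \<Rightarrow> int \<times> int" where
  "hopi_even a = (\<lambda>(p, q). (p + q, p - q + int a - 1))"

definition hopi_odd :: "nat \<Rightarrow> int \<times> int \<Rightarrow> int \<times> int" where
  "hopi_odd a = (\<lambda>(p, q). (p + q, p - q + int a))"

lemma inj_hopi_even: "inj (hopi_even a)"
  by (auto simp: inj_def hopi_even_def)

lemma inj_hopi_odd: "inj (hopi_odd a)"
  by (auto simp: inj_def hopi_odd_def)

lemma hopi_even_neq_hopi_odd: "hopi_even a x \<noteq> hopi_odd a y"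
  by (cases x; cases y) (simp add: hopi_even_def hopi_odd_def, presburger)

lemma hopi_coords:
  obtains p q where "x = hopi_even a (p, q)" | p q where "x = hopi_odd a (p, q)"
proof -
  obtain i j where x: "x = (i, j)" by force
  show ?thesis
  proof (cases "even (i + j - int a)")
    case True
    then obtain p where "i + j - int a = 2 * p" by blast
    then show ?thesis using that(2)[of p "i - p"] by (simp add: x hopi_odd_def)
  next
    case False
    then obtain p where "i + j - int a = 2 * p + 1" using oddE by blast
    \<comment> \<open>Coordinate sums of \<open>hopi_even a (p, q)\<close> are
      \<open>2 * p + int a - 1\<close>, which shifts the first parameter to \<open>p + 1\<close>;
      the second is \<open>i\<close> minus the first.\<close>
    then show ?thesis using that(1)[of "p + 1" "i - p - 1"] by (simp add: x hopi_even_def)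
  qed
qed

lemma eq_hopi_imageI:
  assumes "\<And>p q. hopi_even a (p, q) \<in> A \<longleftrightarrow> p \<in> P \<and> q \<in> Q"
    and "\<And>p q. hopi_odd a (p, q) \<in> A \<longleftrightarrow> p \<in> P' \<and> q \<in> Q'"
  shows "A = hopi_even a ` (P \<times> Q) \<union> hopi_odd a ` (P' \<times> Q')"
proof (rule set_eqI)
  fix x
  show "x \<in> A \<longleftrightarrow> x \<in> hopi_even a ` (P \<times> Q) \<union> hopi_odd a ` (P' \<times> Q')"
  proof (cases x rule: hopi_coords[of _ a])
    case (1 p q)
    then show ?thesis
      using assms(1) hopi_even_neq_hopi_odd by (auto simp: inj_image_mem_iff[OF inj_hopi_even])
  next
    case (2 p q)
    then show ?thesis
      using assms(2) hopi_even_neq_hopi_odd[symmetric]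
      by (auto simp: inj_image_mem_iff[OF inj_hopi_odd])
  qed
qed

lemma card_hopi_image:
  assumes "finite P" "finite Q" "finite P'" "finite Q'"
  shows "card (hopi_even a ` (P \<times> Q) \<union> hopi_odd a ` (P' \<times> Q')) =
    card P * card Q + card P' * card Q'"
proof -
  have "card (hopi_even a ` (P \<times> Q)) = card P * card Q"
    by (simp add: card_image inj_on_subset[OF inj_hopi_even] card_cartesian_product)
  moreover have "card (hopi_odd a ` (P' \<times> Q')) = card P' * card Q'"
    by (simp add: card_image inj_on_subset[OF inj_hopi_odd] card_cartesian_product)
  moreover have "hopi_even a ` (P \<times> Q) \<inter> hopi_odd a ` (P' \<times> Q') = {}"
    using hopi_even_neq_hopi_odd by blast
  ultimately show ?thesis
    using assms by (simp add: card_Un_disjoint)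
qed

text \<open>The bounds on \<open>i + j\<close> restrict only \<open>p\<close>, those on
  \<open>i - j\<close> only \<open>q\<close>. Parity rounds two of the four ranges to half-open
  ones.\<close>

lemma verts_hopi_eq_image:
  "verts (hopi_rectangle a b) =
     hopi_even a ` ({0..int b} \<times> {0..<int a}) \<union> hopi_odd a ` ({0..<int b} \<times> {0..int a})"
  by (rule eq_hopi_imageI) (auto simp: verts_hopi hopi_even_def hopi_odd_def)

text \<open>By parity, points of \<open>hopi_even\<close> meet only the sides with
  \<open>i + j\<close> constant, points of \<open>hopi_odd\<close> only those with
  \<open>i - j\<close> constant, so no vertex is counted on two adjacent sides.\<close>

lemma hopi_sides_eq_image:
  "hopi_sides a b =
     hopi_even a ` ({0, int b} \<times> {0..<int a}) \<union> hopi_odd a ` ({0..<int b} \<times> {0, int a})"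
proof (rule eq_hopi_imageI)
  fix p q
  show "hopi_even a (p, q) \<in> hopi_sides a b \<longleftrightarrow> p \<in> {0, int b} \<and> q \<in> {0..<int a}"
    unfolding hopi_sides_def verts_hopi hopi_even_def by simp presburger
  show "hopi_odd a (p, q) \<in> hopi_sides a b \<longleftrightarrow> p \<in> {0..<int b} \<and> q \<in> {0, int a}"
    unfolding hopi_sides_def verts_hopi hopi_odd_def by simp presburger
qed

lemma card_verts_hopi: "card (verts (hopi_rectangle a b)) = a + b + 2 * a * b"
  by (simp add: verts_hopi_eq_image card_hopi_image nat_add_distrib algebra_simps)

text \<open>Positivity makes \<open>{0, int a}\<close> and \<open>{0, int b}\<close> two-element
  sets, that is, opposite sides distinct.\<close>

lemma card_hopi_sides:
  assumes "a \<ge> 1" "b \<ge> 1"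
  shows "card (hopi_sides a b) = 2 * (a + b)"
  using assms by (simp add: hopi_sides_eq_image card_hopi_image)

theorem theorem20:
  fixes a b :: nat
  assumes "a \<ge> 1" and "b \<ge> 1"
  shows "leaky_forcing_number (hopi_rectangle a b) 2 = 2 * (a + b) \<and>
         leaky_forcing_number (hopi_rectangle a b) 3 = 2 * (a + b) \<and>
         (\<forall>l\<ge>4. leaky_forcing_number (hopi_rectangle a b) l = a + b + 2 * a * b)"
proof -
  let ?G = "hopi_rectangle a b"
  \<comment> \<open>The sides lie in every leaky forcing set once \<open>2 \<le> l\<close>, and
    force by monotonicity as long as \<open>l \<le> 3\<close>.\<close>
  have "leaky_forcing_number ?G l = 2 * (a + b)" if "2 \<le> l" "l \<le> 3" for l
    using that hopi_sides_subset_leaky_forcing_set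
      leaky_forcing_set_mono[OF leaky_forcing_set_hopi_sides]
    by (subst leaky_forcing_number_eqI[OF finite_verts_hopi, where B = "hopi_sides a b"])
      (auto simp: card_hopi_sides[OF assms])
  moreover have "leaky_forcing_number ?G l = a + b + 2 * a * b" if "4 \<le> l" for l
    using that verts_hopi_subset_leaky_forcing_set
    by (subst leaky_forcing_number_eqI[OF finite_verts_hopi leaky_forcing_set_verts])
      (auto simp: card_verts_hopi)
  ultimately show ?thesis by simp
qed

end
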